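(* Let $A \in \mathbf{R}^{m\times N}$, $y\in\mathbf{R}^m$, $\lambda>0$, and assume $0<\mu<\|A\|_2^{-2}$. Let $\{x^{(n)}\}_{n\ge 0}\subset \mathbf{R}^N$ be a sequence generated by the half algorithm, i.e. $x^{(n+1)} = H_{\lambda\mu,\frac12}\big(x^{(n)}-\mu A^T(Ax^{(n)}-y)\big)$ for all $n\ge 0$, and assume that it converges to $x^*\in\mathbf{R}^N$. Let $I=\mathrm{supp}(x^* )$ and $e=\min_{i\in I}|x_i^*|$. If $\sigma_{\min}(A_I^TA_I)>0$ and $$0<\lambda<8e^{3/2}\,\sigma_{\min}(A_I^TA_I),$$ then there exists a constant $\beta_0\in(0,1)$ such that for every $x\in\mathbf{R}^N$ with $\|x-x^*\|_2<\beta_0 e$, $$T_\lambda(x)-T_\lambda(x^* )\ge 0;$$ that is, $x^*$ is a local minimizer of $T_\lambda$.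
   Context: $T_\lambda(x)=\|Ax-y\|_2^2+\lambda\|x\|_{1/2}^{1/2}$, where $\|x\|_{1/2}^{1/2}=\sum_{i=1}^N|x_i|^{1/2}$. $\|A\|_2$ is the spectral norm and $A^T$ the transpose of $A$. Half thresholding operator: for $z\in\mathbf{R}^N$, $H_{\lambda\mu,\frac12}(z)=(h_{\lambda\mu,\frac12}(z_1),\dots,h_{\lambda\mu,\frac12}(z_N))^T$, where for $u\in\mathbf{R}$, $h_{\lambda\mu,\frac12}(u)=f_{\lambda\mu,\frac12}(u)$ if $|u|>\frac{\sqrt[3]{54}}{4}(\lambda\mu)^{2/3}$ and $h_{\lambda\mu,\frac12}(u)=0$ otherwise, with $$f_{\lambda\mu,\frac12}(u)=\tfrac23 u\Big(1+\cos\big(\tfrac{2\pi}{3}-\tfrac23\phi_{\lambda\mu}(u)\big)\Big),\qquad \phi_{\lambda\mu}(u)=\arccos\Big(\tfrac{\lambda\mu}{8}\big(\tfrac{|u|}{3}\big)^{-3/2}\Big).$$ The initial point $x^{(0)}\in\mathbf{R}^N$ is arbitrary. $\mathrm{supp}(x)=\{i: x_i\ne 0\}$. For an index set $S$, $A_S$ is the submatrix of $A$ consisting of the columns indexed by $S$, and $\sigma_{\min}(A_S^TA_S)$ is the minimal singular value of $A_S^TA_S$. The definition of $e$ presupposes that $I$ is nonempty. *)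

theory Defs
  imports "HOL-Analysis.Analysis"
begin

definition T :: "real^'n^'m \<Rightarrow> real^'m \<Rightarrow> real \<Rightarrow> real^'n \<Rightarrow> real" where
  "T A y lam x = (norm (A *v x - y))\<^sup>2 + lam * (\<Sum>i\<in>UNIV. \<bar>x $ i\<bar> powr (1/2))"

definition spectral_norm :: "real^'n^'m \<Rightarrow> real" where
  "spectral_norm A = onorm (\<lambda>v. A *v v)"

text \<open>In the thresholding functions the parameter \<open>t\<close> is the product \<open>\<lambda>\<mu>\<close>.\<close>

definition half_phi :: "real \<Rightarrow> real \<Rightarrow> real" where
  "half_phi t u = arccos (t / 8 * (\<bar>u\<bar> / 3) powr (-3/2))"

definition half_f :: "real \<Rightarrow> real \<Rightarrow> real" where
  "half_f t u = 2/3 * u * (1 + cos (2 * pi / 3 - 2/3 * half_phi t u))"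

definition half_h :: "real \<Rightarrow> real \<Rightarrow> real" where
  "half_h t u = (if \<bar>u\<bar> > root 3 54 / 4 * t powr (2/3) then half_f t u else 0)"

definition half_H :: "real \<Rightarrow> real^'n \<Rightarrow> real^'n" where
  "half_H t z = (\<chi> i. half_h t (z $ i))"

definition supp :: "real^'n \<Rightarrow> 'n set" where
  "supp x = {i. x $ i \<noteq> 0}"

text \<open>
  The size of the submatrix \<open>A\<^sub>S\<close> depends on the set \<open>S\<close>, so matrices with set-indexed rows
  and columns are represented by functions of two indices together with explicit index sets;
  entries outside the index sets are irrelevant.  In particular, an eigenvector of a matrix
  indexed by \<open>S \<times> S\<close> must be nonzero at some index in \<open>S\<close>, so the zeros
  outside \<open>S\<close> do not contribute any eigenvalue.
\<close>

definition col_submatrix :: "real^'n^'m \<Rightarrow> 'n set \<Rightarrow> 'm \<Rightarrow> 'n \<Rightarrow> real" where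
  "col_submatrix A S = (\<lambda>i j. if j \<in> S then A $ i $ j else 0)"

definition transp_fun :: "('i \<Rightarrow> 'j \<Rightarrow> real) \<Rightarrow> 'j \<Rightarrow> 'i \<Rightarrow> real" where
  "transp_fun M = (\<lambda>j i. M i j)"

definition mult_over :: "'k set \<Rightarrow> ('i \<Rightarrow> 'k \<Rightarrow> real) \<Rightarrow> ('k \<Rightarrow> 'j \<Rightarrow> real) \<Rightarrow> 'i \<Rightarrow> 'j \<Rightarrow> real" where
  "mult_over K M L = (\<lambda>i j. \<Sum>k\<in>K. M i k * L k j)"

definition eigenvalue_on :: "'i set \<Rightarrow> ('i \<Rightarrow> 'i \<Rightarrow> real) \<Rightarrow> real \<Rightarrow> bool" where
  "eigenvalue_on S M c \<longleftrightarrow>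
     (\<exists>v. (\<exists>i\<in>S. v i \<noteq> 0) \<and> (\<forall>i\<in>S. (\<Sum>j\<in>S. M i j * v j) = c * v i))"

definition singular_values_on :: "'i set \<Rightarrow> ('i \<Rightarrow> 'i \<Rightarrow> real) \<Rightarrow> real set" where
  "singular_values_on S M = {sqrt c |c. eigenvalue_on S (mult_over S (transp_fun M) M) c}"

definition sigma_min_on :: "'i set \<Rightarrow> ('i \<Rightarrow> 'i \<Rightarrow> real) \<Rightarrow> real" where
  "sigma_min_on S M = Min (singular_values_on S M)"

definition sigma_min_gram :: "real^'n^'m \<Rightarrow> 'n set \<Rightarrow> real" where
  "sigma_min_gram A S =
     sigma_min_on S (mult_over UNIV (transp_fun (col_submatrix A S)) (col_submatrix A S))"

end

theory Submission
  imports Defs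
begin

text \<open>
  A nonzero value \<open>v = h(u)\<close> of the half thresholding function solves
  \<open>u - v = (t/4) sgn v / \<surd>\<bar>v\<bar>\<close> (Vieta's trigonometric solution of a cubic), so passing to the
  limit in the iteration shows that the gradient of \<open>T\<close> vanishes in the coordinates of the support
  \<open>I\<close>.  For a perturbation \<open>p + q\<close> of the limit with \<open>p\<close> supported on \<open>I\<close> and \<open>q\<close> off \<open>I\<close>, the
  quadratic gain \<open>\<sigma> \<parallel>p\<parallel>\<^sup>2\<close> beats the concavity loss of the square roots on \<open>I\<close>, which is about
  \<open>\<lambda>/(8 e\<^bsup>3/2\<^esup>) \<parallel>p\<parallel>\<^sup>2\<close>, while off \<open>I\<close> the terms \<open>\<lambda> \<surd>\<bar>q\<^sub>i\<bar>\<close> dominate everything linear in \<open>q\<close>.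
\<close>

section \<open>The thresholding function\<close>

lemma half_f_uminus: "half_f t (- u) = - half_f t u"
  by (simp add: half_f_def half_phi_def)

lemma powr_three_halves:
  fixes a :: real
  assumes "0 \<le> a"
  shows "a powr (3/2) = sqrt a ^ 3"
proof -
  have "sqrt a ^ 3 = (a powr (1/2)) powr 3"
    using assms by (simp add: powr_half_sqrt flip: powr_numeral)
  also have "\<dots> = a powr (3/2)" by (simp only: powr_powr) simp
  finally show ?thesis by simp
qed

text \<open>Ensures that the argument of \<open>arccos\<close> in \<open>half_phi\<close> is at most
  1, so that \<open>cos\<close> undoes \<open>arccos\<close>. This needs u^3 >= 27/64 t^2, and the
  cube of the threshold is 27/32 t^2, twice as much.\<close>

lemma half_threshold_imp_arccos_arg:
  assumes t: "t > 0" and u: "u > root 3 54 / 4 * t powr (2/3)"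
  shows "t / 8 \<le> sqrt (u/3) ^ 3"
proof -
  let ?c = "root 3 54 / 4 * t powr (2/3)"
  have c0: "0 < ?c" using t by simp
  have "(t powr (2/3)) ^ 3 = t\<^sup>2"
  proof -
    have "(t powr (2/3)) ^ 3 = (t powr (2/3)) powr 3" using t by (simp flip: powr_numeral)
    also have "\<dots> = t powr 2" by (simp only: powr_powr) simp
    finally show ?thesis using t by simp
  qed
  then have "?c ^ 3 = 54 / 64 * t\<^sup>2"
    by (simp add: power_mult_distrib power_divide)
  moreover have "?c ^ 3 \<le> u ^ 3" using u c0 by (intro power_mono) auto
  ultimately have "54 / 64 * t\<^sup>2 \<le> u ^ 3" by simp
  then have "t\<^sup>2 / 64 \<le> u ^ 3 / 27" using zero_le_power2[of t] by linarith
  then have "(t/8)\<^sup>2 \<le> (u/3) ^ 3" by (simp add: power_divide)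
  also have "\<dots> = (sqrt (u/3) ^ 3)\<^sup>2"
  proof -
    have "(sqrt (u/3) ^ 3)\<^sup>2 = ((sqrt (u/3))\<^sup>2) ^ 3" by (simp flip: power_mult)
    then show ?thesis using u c0 by simp
  qed
  finally show ?thesis using u c0 by (intro power2_le_imp_le[of "t/8"]) auto
qed

text \<open>With s = sqrt (u/3) and ph = \<open>half_phi t u\<close>, the square root of
  \<open>half_f t u\<close> is w = 2 s cos (pi/3 - ph/3). The identity amounts to w^3 - u w + t/4 =
  0, which for this w is the triple-angle formula.\<close>

lemma half_f_pos_stationary:
  assumes t: "t > 0" and u: "u > root 3 54 / 4 * t powr (2/3)"
  shows "half_f t u > 0" and "u - half_f t u = t / 4 / sqrt (half_f t u)"
proof -
  have "0 < root 3 54 / 4 * t powr (2/3)" using t by simp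
  then have u0: "0 < u" using u by linarith
  define s where "s = sqrt (u/3)"
  have s0: "0 < s" using u0 by (simp add: s_def)
  have s2: "u = 3 * s\<^sup>2" using u0 by (simp add: s_def)
  have le: "t / 8 \<le> s ^ 3"
    using half_threshold_imp_arccos_arg[OF t u] by (simp add: s_def)
  define ph where "ph = half_phi t u"
  have "(u/3) powr (-3/2) = inverse (s ^ 3)"
    using powr_minus[of "u/3" "3/2"] powr_three_halves[of "u/3"] u0 by (simp add: s_def)
  then have ph: "ph = arccos (t / 8 / s ^ 3)"
    unfolding ph_def half_phi_def using u0 by (simp only: abs_of_pos divide_inverse)
  have arg: "0 \<le> t / 8 / s ^ 3" "t / 8 / s ^ 3 \<le> 1"
    using le s0 t by (simp_all add: divide_simps)
  have cosph: "cos ph = t / 8 / s ^ 3" using arg unfolding ph by (intro cos_arccos) auto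
  have phb: "0 \<le> ph" "ph \<le> pi" unfolding ph using arg by (auto intro: arccos_lbound arccos_ubound)
  \<comment> \<open>Half the angle occurring in \<open>half_f\<close>: since 1 + cos (2 x) = 2 (cos
    x)^2, it makes \<open>half_f t u\<close> the square of \<open>2 * s * c\<close>.\<close>
  define c where "c = cos (pi/3 - ph/3)"
  have c0: "0 < c" unfolding c_def 
  proof (rule cos_gt_zero_pi)
    show "- (pi/2) < pi/3 - ph/3" "pi/3 - ph/3 < pi/2" using phb pi_gt_zero by linarith+
  qed
  have f: "half_f t u = (2 * s * c)\<^sup>2"
  proof -
    have "cos (2 * pi / 3 - 2/3 * ph) = cos (2 * (pi/3 - ph/3))" by (simp add: algebra_simps)
    also have "\<dots> = 2 * c\<^sup>2 - 1" by (simp only: cos_double_cos c_def)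
    finally show ?thesis unfolding half_f_def ph_def[symmetric]
      by (simp add: s2 power_mult_distrib)
  qed
  show "half_f t u > 0" using f s0 c0 by simp
  \<comment> \<open>Tripling the angle gives pi - ph, whose cosine is the negative of the known
    value of cos ph.\<close>
  have "4 * c ^ 3 - 3 * c = cos (3 * (pi/3 - ph/3))"
    by (simp only: cos_treble_cos c_def)
  also have "3 * (pi/3 - ph/3) = pi - ph" by (simp add: algebra_simps)
  finally have "4 * c ^ 3 - 3 * c = - (t / 8 / s ^ 3)" using cosph by simp
  then have cub: "s ^ 3 * (3 * c - 4 * c ^ 3) = t / 8" using s0 by (simp add: field_simps)
  have "(u - half_f t u) * (2 * s * c) = 2 * (s ^ 3 * (3 * c - 4 * c ^ 3))"
    unfolding f unfolding s2 by algebra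
  also have "\<dots> = t / 4" using cub by simp
  finally have "u - half_f t u = t / 4 / (2 * s * c)" using s0 c0 by (simp add: eq_divide_eq)
  moreover have "sqrt (half_f t u) = 2 * s * c" unfolding f using s0 c0 by simp
  ultimately show "u - half_f t u = t / 4 / sqrt (half_f t u)" by simp
qed

text \<open>This is the first-order condition at v = \<open>half_h t u\<close> for minimizing (v -
  u)^2 + t sqrt |v|. A nonzero value comes from the branch above the threshold, and negative u
  reduce to positive ones because \<open>half_f\<close> is odd.\<close>

lemma half_h_stationary:
  assumes t: "t > 0" and nz: "half_h t u \<noteq> 0"
  shows "u - half_h t u = t / 4 * (sgn (half_h t u) / sqrt \<bar>half_h t u\<bar>)"
proof -
  have gt: "\<bar>u\<bar> > root 3 54 / 4 * t powr (2/3)" and h: "half_h t u = half_f t u"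
    using nz by (auto simp: half_h_def split: if_splits)
  note F = half_f_pos_stationary[OF t gt]
  show ?thesis
  proof (cases "u \<ge> 0")
    case True
    then show ?thesis using F by (simp add: h)
  next
    case False
    then have "\<bar>u\<bar> = - u" by simp
    with F show ?thesis by (simp add: h half_f_uminus)
  qed
qed

section \<open>The least singular value of a Gram matrix\<close>

text \<open>Makes the \<open>Min\<close> in \<open>sigma_min_on\<close> usable. Eigenvectors of a
  symmetric matrix for distinct eigenvalues are orthogonal, hence independent, so the dimension
  bounds the number of eigenvalues.\<close>

lemma finite_singular_values_on:
  fixes M :: "'n::finite \<Rightarrow> 'n \<Rightarrow> real"
  shows "finite (singular_values_on S M)"
proof -
  define N where "N = mult_over S (transp_fun M) M"
  have sym: "N i j = N j i" for i j
    by (simp add: N_def mult_over_def transp_fun_def mult.commute)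
  let ?E = "Collect (eigenvalue_on S N)"
  define P where "P c v \<longleftrightarrow> (\<exists>i\<in>S. v i \<noteq> 0) \<and> (\<forall>i\<in>S. (\<Sum>j\<in>S. N i j * v j) = c * v i)"
    for c and v :: "'n \<Rightarrow> real"
  have "\<forall>c\<in>?E. \<exists>v. P c v" by (auto simp: eigenvalue_on_def P_def)
  then obtain v where v: "\<And>c. c \<in> ?E \<Longrightarrow> P c (v c)" by metis
  \<comment> \<open>Values of an eigenvector outside \<open>S\<close> are arbitrary; setting them to
    zero turns sums over \<open>S\<close> into inner products.\<close>
  define w :: "real \<Rightarrow> real^'n" where "w c = (\<chi> i. if i \<in> S then v c i else 0)" for c
  have inner: "w c \<bullet> w d = (\<Sum>i\<in>S. v c i * v d i)" for c d
    by (auto simp: w_def inner_vec_def if_distrib[of "\<lambda>x. x * _"] sum.If_cases intro!: sum.cong)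
  have nz: "w c \<noteq> 0" if "c \<in> ?E" for c
    using v[OF that] by (auto simp: P_def w_def vec_eq_iff)
  have orth: "w c \<bullet> w d = 0" if "c \<in> ?E" "d \<in> ?E" "c \<noteq> d" for c d
  proof -
    have "c * (w c \<bullet> w d) = (\<Sum>i\<in>S. (\<Sum>j\<in>S. N i j * v c j) * v d i)"
      using v[OF that(1)] by (simp add: inner P_def sum_distrib_left mult.assoc)
    also have "\<dots> = (\<Sum>i\<in>S. \<Sum>j\<in>S. N i j * v c j * v d i)"
      by (simp add: sum_distrib_right)
    also have "\<dots> = (\<Sum>j\<in>S. \<Sum>i\<in>S. N i j * v c j * v d i)" by (rule sum.swap)
    also have "\<dots> = (\<Sum>j\<in>S. (\<Sum>i\<in>S. N j i * v d i) * v c j)"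
      by (simp add: sum_distrib_right sum_distrib_left sym mult_ac)
    also have "\<dots> = d * (w c \<bullet> w d)"
      using v[OF that(2)] by (simp add: inner P_def sum_distrib_left mult_ac)
    finally show ?thesis using that(3) by simp
  qed
  have inj: "inj_on w ?E"
    using orth nz by (intro inj_onI) (metis inner_eq_zero_iff)
  have "pairwise orthogonal (w ` ?E)"
    using orth by (auto simp: pairwise_def orthogonal_def)
  moreover have "0 \<notin> w ` ?E" using nz by auto
  ultimately have "independent (w ` ?E)" by (rule pairwise_orthogonal_independent)
  then have "finite (w ` ?E)" using independent_bound by blast
  then have "finite ?E" using inj finite_image_iff by blast
  moreover have "singular_values_on S M = sqrt ` ?E"
    by (auto simp: singular_values_on_def N_def)
  ultimately show ?thesis by simp
qed

text \<open>The form in which a first variation is used: a minimum at t = 0 forces the derivative 2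
  B there to vanish.\<close>

lemma linear_term_zero_if_quadratic_nonneg:
  fixes B D :: real
  assumes "\<And>t. 0 \<le> 2 * t * B + t\<^sup>2 * D"
  shows "B = 0"
proof -
  have "(\<lambda>t. 2 * t * B + t\<^sup>2 * D) 0 \<le> (\<lambda>t. 2 * t * B + t\<^sup>2 * D) t" for t
    using assms by simp
  moreover have "((\<lambda>t. 2 * t * B + t\<^sup>2 * D) has_real_derivative 2 * B) (at 0)"
    by (auto intro!: derivative_eq_intros)
  ultimately have "2 * B = 0"
    by (intro DERIV_local_min[of "\<lambda>t. 2 * t * B + t\<^sup>2 * D" _ 0 1]) auto
  then show ?thesis by simp
qed

lemma power2_norm_add_scaleR:
  fixes a b :: "'a::real_inner"
  shows "(norm (a + t *\<^sub>R b))\<^sup>2 = (norm a)\<^sup>2 + 2 * t * (a \<bullet> b) + t\<^sup>2 * (norm b)\<^sup>2"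
  unfolding power2_norm_eq_inner
  by (simp add: inner_add_left inner_add_right inner_commute power2_eq_square distrib_left)

text \<open>Let c be the minimum of |A v|^2 over unit vectors supported on \<open>S\<close>,
  attained by compactness. A minimizer is an eigenvector of the Gram matrix for c, so c is among the
  singular values whose minimum is \<open>sigma_min_gram A S\<close>.\<close>

lemma sigma_min_gram_le_quadratic_form:
  fixes A :: "real^'n^'m" and p :: "real^'n"
  assumes ne: "S \<noteq> {}" and p: "\<And>i. i \<notin> S \<Longrightarrow> p $ i = 0"
  shows "sigma_min_gram A S * (norm p)\<^sup>2 \<le> (norm (A *v p))\<^sup>2"
proof -
  define V where "V = {v::real^'n. \<forall>i. i \<notin> S \<longrightarrow> v $ i = 0}"
  define K where "K = V \<inter> sphere 0 1"
  have "V = (\<Inter>i\<in>-S. {v. v $ i = 0})" by (auto simp: V_def)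
  moreover have "closed {v::real^'n. v $ i = 0}" for i
    by (intro closed_Collect_eq continuous_intros)
  ultimately have "closed V" by auto
  then have "compact K" unfolding K_def by (intro closed_Int_compact) auto
  moreover obtain i0 where "i0 \<in> S" using ne by auto
  then have "axis i0 1 \<in> K" by (auto simp: K_def V_def axis_def norm_axis_1[unfolded axis_def])
  then have "K \<noteq> {}" by auto
  moreover have "continuous_on K (\<lambda>v. (norm (A *v v))\<^sup>2)"
    by (intro continuous_intros linear_continuous_on) (simp add: matrix_vector_mul_bounded_linear)
  ultimately obtain v where v: "v \<in> K" and vmin: "\<And>w. w \<in> K \<Longrightarrow> (norm (A *v v))\<^sup>2 \<le> (norm (A *v w))\<^sup>2"
    using continuous_attains_inf[of K "\<lambda>v. (norm (A *v v))\<^sup>2"] by auto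
  define c where "c = (norm (A *v v))\<^sup>2"
  have c0: "0 \<le> c" by (simp add: c_def)
  have nv: "norm v = 1" and vV: "v \<in> V" using v by (auto simp: K_def)
  have ray: "c * (norm w)\<^sup>2 \<le> (norm (A *v w))\<^sup>2" if "w \<in> V" for w
  proof (cases "w = 0")
    case False
    let ?w = "(1 / norm w) *\<^sub>R w"
    have "?w \<in> K" using that False by (auto simp: K_def V_def)
    from vmin[OF this] have "c \<le> (norm (A *v w))\<^sup>2 / (norm w)\<^sup>2"
      by (simp add: c_def matrix_vector_mult_scaleR power_divide)
    then show ?thesis using False by (simp add: field_simps)
  qed simp
  \<comment> \<open>By \<open>ray\<close> the form |A w|^2 - c |w|^2 is nonnegative on
    \<open>V\<close>, and it vanishes at \<open>v\<close>; hence its linear term at \<open>v\<close>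
    is zero in every direction of \<open>V\<close>.\<close>
  have crit: "(A *v v) \<bullet> (A *v w) = c * (v \<bullet> w)" if w: "w \<in> V" for w
  proof -
    let ?B = "(A *v v) \<bullet> (A *v w) - c * (v \<bullet> w)"
    let ?D = "(norm (A *v w))\<^sup>2 - c * (norm w)\<^sup>2"
    have "0 \<le> 2 * t * ?B + t\<^sup>2 * ?D" for t
    proof -
      have "v + t *\<^sub>R w \<in> V" using w vV by (auto simp: V_def)
      from ray[OF this] have "c * (norm (v + t *\<^sub>R w))\<^sup>2 \<le> (norm (A *v v + t *\<^sub>R (A *v w)))\<^sup>2"
        by (simp add: matrix_vector_right_distrib matrix_vector_mult_scaleR)
      then show ?thesis using nv
        unfolding power2_norm_add_scaleR by (simp add: c_def algebra_simps)
    qed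
    then have "?B = 0" by (rule linear_term_zero_if_quadratic_nonneg)
    then show ?thesis by simp
  qed
  define G where "G = mult_over UNIV (transp_fun (col_submatrix A S)) (col_submatrix A S)"
  have Gsym: "G i j = G j i" for i j
    by (simp add: G_def mult_over_def transp_fun_def mult.commute)
  \<comment> \<open>The condition \<open>crit\<close>, tested with the unit vectors
    \<open>axis i 1\<close> for i in \<open>S\<close>, is the eigenvalue equation.\<close>
  have Gv: "(\<Sum>j\<in>S. G i j * v $ j) = c * v $ i" if i: "i \<in> S" for i
  proof -
    have Av: "(A *v v) $ k = (\<Sum>j\<in>S. A $ k $ j * v $ j)" for k
      unfolding matrix_vector_mult_def using vV
      by (auto simp: V_def intro!: sum.mono_neutral_right)
    have "(\<Sum>j\<in>S. G i j * v $ j) = (\<Sum>j\<in>S. \<Sum>k\<in>UNIV. A $ k $ i * A $ k $ j * v $ j)"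
      using i by (simp add: G_def mult_over_def transp_fun_def col_submatrix_def sum_distrib_right)
    also have "\<dots> = (\<Sum>k\<in>UNIV. \<Sum>j\<in>S. A $ k $ i * A $ k $ j * v $ j)" by (rule sum.swap)
    also have "\<dots> = (\<Sum>k\<in>UNIV. (A *v v) $ k * A $ k $ i)"
      by (simp add: Av sum_distrib_left sum_distrib_right mult_ac)
    also have "\<dots> = (A *v v) \<bullet> (A *v axis i 1)"
      by (simp add: inner_vec_def matrix_vector_mult_basis column_def)
    also have "\<dots> = c * (v \<bullet> axis i 1)" using i by (intro crit) (auto simp: V_def axis_def)
    finally show ?thesis by (simp add: inner_axis)
  qed
  \<comment> \<open>Singular values of \<open>G\<close> are defined through its transpose times
    itself; by symmetry this is \<open>G\<close> applied twice, which gives c^2.\<close>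
  have "eigenvalue_on S (mult_over S (transp_fun G) G) (c\<^sup>2)"
    unfolding eigenvalue_on_def
  proof (intro exI[of _ "\<lambda>i. v $ i"] conjI ballI)
    have "v \<noteq> 0" using nv by auto
    then obtain j where "v $ j \<noteq> 0" by (auto simp: vec_eq_iff)
    then show "\<exists>i\<in>S. v $ i \<noteq> 0" using vV by (auto simp: V_def)
    fix i assume i: "i \<in> S"
    have "(\<Sum>j\<in>S. mult_over S (transp_fun G) G i j * v $ j) = (\<Sum>j\<in>S. \<Sum>k\<in>S. G i k * G k j * v $ j)"
      by (simp add: mult_over_def transp_fun_def sum_distrib_right Gsym)
    also have "\<dots> = (\<Sum>k\<in>S. \<Sum>j\<in>S. G i k * G k j * v $ j)" by (rule sum.swap)
    also have "\<dots> = (\<Sum>k\<in>S. G i k * (\<Sum>j\<in>S. G k j * v $ j))"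
      by (simp add: sum_distrib_left mult.assoc)
    also have "\<dots> = (\<Sum>k\<in>S. G i k * (c * v $ k))" by (simp add: Gv)
    also have "\<dots> = c * (\<Sum>k\<in>S. G i k * v $ k)" by (simp add: sum_distrib_left mult_ac)
    also have "\<dots> = c\<^sup>2 * v $ i" using i by (simp add: Gv power2_eq_square)
    finally show "(\<Sum>j\<in>S. mult_over S (transp_fun G) G i j * v $ j) = c\<^sup>2 * v $ i" .
  qed
  then have "sqrt (c\<^sup>2) \<in> singular_values_on S G" unfolding singular_values_on_def by blast
  then have "c \<in> singular_values_on S G" using c0 by simp
  then have "sigma_min_gram A S \<le> c"
    unfolding sigma_min_gram_def sigma_min_on_def G_def[symmetric]
    by (intro Min_le finite_singular_values_on)
  then have "sigma_min_gram A S * (norm p)\<^sup>2 \<le> c * (norm p)\<^sup>2" by (intro mult_right_mono) auto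
  also have "\<dots> \<le> (norm (A *v p))\<^sup>2" using p by (intro ray) (auto simp: V_def)
  finally show ?thesis .
qed

section \<open>Local minimality\<close>

text \<open>With b and s the roots of |a| and |a + h|, s = b + (s^2 - b^2)/(2b) - (s - b)^2/(2b)
  holds exactly. The bound on h prevents a change of sign and gives s >= \<theta> b, so |s - b| =
  |h|/(s + b) <= |h|/((1 + \<theta>) b). As \<theta> tends to 1 the quadratic coefficient tends to
  the Taylor value 1/(8 b^3).\<close>

lemma sqrt_abs_add_ge:
  fixes a h \<theta> :: real
  assumes a: "a \<noteq> 0" and \<theta>: "0 \<le> \<theta>" "\<theta> \<le> 1" and h: "\<bar>h\<bar> \<le> (1 - \<theta>\<^sup>2) * \<bar>a\<bar>"
  shows "sqrt \<bar>a + h\<bar> \<ge> sqrt \<bar>a\<bar> + sgn a / (2 * sqrt \<bar>a\<bar>) * h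
           - h\<^sup>2 / (2 * (1 + \<theta>)\<^sup>2 * sqrt \<bar>a\<bar> ^ 3)"
proof -
  define b where "b = sqrt \<bar>a\<bar>"
  define s where "s = sqrt \<bar>a + h\<bar>"
  have b: "0 < b" "b\<^sup>2 = \<bar>a\<bar>" using a by (simp_all add: b_def)
  have s: "0 \<le> s" "s\<^sup>2 = \<bar>a + h\<bar>" by (simp_all add: s_def)
  have "(1 - \<theta>\<^sup>2) * \<bar>a\<bar> \<le> 1 * \<bar>a\<bar>" by (intro mult_right_mono) auto
  then have "\<bar>h\<bar> \<le> \<bar>a\<bar>" using h by linarith
  then have sh: "s\<^sup>2 - b\<^sup>2 = sgn a * h"
    using a by (cases "a > 0") (auto simp: s b)
  have "(\<theta> * b)\<^sup>2 \<le> s\<^sup>2"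
    using h unfolding s power_mult_distrib b by (simp add: algebra_simps)
  then have "\<theta> * b \<le> s" using s(1) by (rule power2_le_imp_le)
  then have sb: "(1 + \<theta>) * b \<le> s + b" by (simp add: algebra_simps)
  have h2: "h\<^sup>2 = (s - b)\<^sup>2 * (s + b)\<^sup>2"
  proof -
    have "h\<^sup>2 = (sgn a * h)\<^sup>2" using a by (auto simp: power_mult_distrib sgn_if)
    then show ?thesis unfolding sh[symmetric] by algebra
  qed
  have "(s - b)\<^sup>2 / (2 * b) \<le> h\<^sup>2 / (2 * (1 + \<theta>)\<^sup>2 * b ^ 3)"
  proof -
    have "((1 + \<theta>) * b)\<^sup>2 \<le> (s + b)\<^sup>2" using sb b \<theta> by (intro power_mono) auto
    then have "(s - b)\<^sup>2 * ((1 + \<theta>) * b)\<^sup>2 \<le> h\<^sup>2" unfolding h2 by (intro mult_left_mono) auto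
    moreover have "(s - b)\<^sup>2 / (2 * b) = (s - b)\<^sup>2 * ((1 + \<theta>) * b)\<^sup>2 / (2 * (1 + \<theta>)\<^sup>2 * b ^ 3)"
    proof -
      have "b \<noteq> 0" "1 + \<theta> \<noteq> 0" using b \<theta> by auto
      then show ?thesis by (simp add: divide_simps power2_eq_square power3_eq_cube)
    qed
    ultimately show ?thesis using b \<theta> by (simp add: divide_right_mono)
  qed
  moreover have "s = b + sgn a / (2 * b) * h - (s - b)\<^sup>2 / (2 * b)"
  proof -
    have "sgn a / (2 * b) * h = (s\<^sup>2 - b\<^sup>2) / (2 * b)" by (simp add: sh)
    also have "\<dots> = s - b + (s - b)\<^sup>2 / (2 * b)"
      using b(1) by (simp add: divide_simps power2_eq_square algebra_simps)
    finally show ?thesis by simp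
  qed
  ultimately show ?thesis unfolding b_def[symmetric] s_def[symmetric] by linarith
qed

lemma T_alt: "T A y lam x = (norm (A *v x - y))\<^sup>2 + lam * (\<Sum>i\<in>UNIV. sqrt \<bar>x $ i\<bar>)"
  by (simp add: T_def powr_half_sqrt)

text \<open>\<open>half_h\<close> jumps at its threshold, so the limit is not passed through it. It
  is passed through the identity of \<open>half_h_stationary\<close>, whose right-hand side is
  continuous away from zero and which holds eventually because the limit coordinate is
  nonzero.\<close>

lemma half_iteration_limit_stationary:
  fixes A :: "real^'N^'m"
  assumes lam: "lam > 0" and mu: "mu > 0"
    and step: "\<And>n. x (Suc n) = half_H (lam * mu) (x n - mu *\<^sub>R (transpose A *v (A *v x n - y)))"
    and lim: "x \<longlonglongrightarrow> xs" and i: "xs $ i \<noteq> 0"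
  shows "(transpose A *v (A *v xs - y)) $ i = - (lam / 4 * (sgn (xs $ i) / sqrt \<bar>xs $ i\<bar>))"
proof -
  define g where "g w = transpose A *v (A *v w - y)" for w
  have Al: "(\<lambda>n. B *v f n) \<longlonglongrightarrow> B *v l" if "f \<longlonglongrightarrow> l" for B :: "real^'a^'b" and f l
    using that by (intro bounded_linear.tendsto[OF matrix_vector_mul_bounded_linear])
  have gl: "(\<lambda>n. g (x n)) \<longlonglongrightarrow> g xs"
    unfolding g_def by (intro Al tendsto_intros lim)
  have limS: "(\<lambda>n. x (Suc n) $ i) \<longlonglongrightarrow> xs $ i"
    using LIMSEQ_Suc[OF lim] by (rule tendsto_vec_nth)
  have L: "(\<lambda>n. (x n $ i - mu * g (x n) $ i) - x (Suc n) $ i) \<longlonglongrightarrow> (xs $ i - mu * g xs $ i) - xs $ i"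
    by (intro tendsto_intros limS lim gl)
  have R: "(\<lambda>n. lam * mu / 4 * (sgn (x (Suc n) $ i) / sqrt \<bar>x (Suc n) $ i\<bar>))
             \<longlonglongrightarrow> lam * mu / 4 * (sgn (xs $ i) / sqrt \<bar>xs $ i\<bar>)"
    using i by (intro tendsto_intros limS tendsto_sgn) auto
  have "\<forall>\<^sub>F n in sequentially. x (Suc n) $ i \<noteq> 0"
    using limS i by (rule tendsto_imp_eventually_ne)
  then have "\<forall>\<^sub>F n in sequentially. (x n $ i - mu * g (x n) $ i) - x (Suc n) $ i
      = lam * mu / 4 * (sgn (x (Suc n) $ i) / sqrt \<bar>x (Suc n) $ i\<bar>)"
  proof (rule eventually_mono)
    fix n assume nz: "x (Suc n) $ i \<noteq> 0"
    have "x (Suc n) $ i = half_h (lam * mu) (x n $ i - mu * g (x n) $ i)"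
      by (simp add: step[of n] half_H_def g_def)
    with nz show "(x n $ i - mu * g (x n) $ i) - x (Suc n) $ i
      = lam * mu / 4 * (sgn (x (Suc n) $ i) / sqrt \<bar>x (Suc n) $ i\<bar>)"
      using half_h_stationary[of "lam * mu" "x n $ i - mu * g (x n) $ i"] lam mu by simp
  qed
  then have "(\<lambda>n. lam * mu / 4 * (sgn (x (Suc n) $ i) / sqrt \<bar>x (Suc n) $ i\<bar>))
             \<longlonglongrightarrow> (xs $ i - mu * g xs $ i) - xs $ i"
    using L by (rule Lim_transform_eventually[rotated])
  with R have "(xs $ i - mu * g xs $ i) - xs $ i = lam * mu / 4 * (sgn (xs $ i) / sqrt \<bar>xs $ i\<bar>)"
    using LIMSEQ_unique by blast
  then have "mu * g xs $ i = mu * - (lam / 4 * (sgn (xs $ i) / sqrt \<bar>xs $ i\<bar>))"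
    by (simp add: algebra_simps)
  then show ?thesis using mu unfolding g_def by (metis mult_left_cancel less_irrefl)
qed

text \<open>Once the quadratic gain on the support is bounded below by \<sigma> |p|^2 and all terms
  linear in q are gathered into one inner product, the claim splits into a scalar inequality for
  each coordinate.\<close>

lemma T_ge_near_stationary_point:
  fixes A :: "real^'N^'m" and xs :: "real^'N"
  assumes lam: "lam > 0" and e: "e > 0" and supp_ne: "supp xs \<noteq> {}"
    and ebd: "\<And>i. i \<in> supp xs \<Longrightarrow> e \<le> \<bar>xs $ i\<bar>"
    and stat: "\<And>i. i \<in> supp xs \<Longrightarrow>
        (transpose A *v (A *v xs - y)) $ i = - (lam / 4 * (sgn (xs $ i) / sqrt \<bar>xs $ i\<bar>))"
    and lam_lt: "lam < 8 * e powr (3/2) * sigma_min_gram A (supp xs)"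
  shows "\<exists>\<beta>. 0 < \<beta> \<and> \<beta> < 1 \<and> (\<forall>z. norm (z - xs) < \<beta> * e \<longrightarrow> T A y lam xs \<le> T A y lam z)"
proof -
  let ?I = "supp xs"
  define \<sigma> where "\<sigma> = sigma_min_gram A ?I"
  define d where "d = sqrt e ^ 3"
  have d0: "0 < d" using e by (simp add: d_def)
  have lam8: "lam < 8 * d * \<sigma>"
    using lam_lt e by (simp add: \<sigma>_def d_def powr_three_halves)
  \<comment> \<open>The strict inequality in \<open>lam8\<close> leaves room: 2 (1 + \<theta>)^2
    tends to 8 as \<theta> tends to 1 from below.\<close>
  obtain \<theta> where \<theta>: "0 < \<theta>" "\<theta> < 1" and \<theta>\<sigma>: "lam < 2 * (1 + \<theta>)\<^sup>2 * d * \<sigma>"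
  proof -
    have "((\<lambda>\<theta>. 2 * (1 + \<theta>)\<^sup>2 * d * \<sigma>) \<longlongrightarrow> 2 * (1 + 1)\<^sup>2 * d * \<sigma>) (at_left 1)"
      by (intro tendsto_intros)
    moreover have "lam < 2 * (1 + 1)\<^sup>2 * d * \<sigma>" using lam8 by simp
    ultimately have "\<forall>\<^sub>F \<theta> in at_left 1. lam < 2 * (1 + \<theta>)\<^sup>2 * d * \<sigma>"
      by (rule order_tendstoD)
    moreover have "\<forall>\<^sub>F \<theta> in at_left (1::real). \<theta> \<in> {0<..<1}"
      by (intro eventually_at_left_real) simp
    ultimately have "\<forall>\<^sub>F \<theta> in at_left 1. lam < 2 * (1 + \<theta>)\<^sup>2 * d * \<sigma> \<and> \<theta> \<in> {0<..<1}"
      by (rule eventually_conj)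
    then have "\<exists>\<theta>. lam < 2 * (1 + \<theta>)\<^sup>2 * d * \<sigma> \<and> \<theta> \<in> {0<..<1}"
      using eventually_happens by force
    with that show ?thesis by auto
  qed
  \<comment> \<open>The loss from concavity per unit of squared perturbation on the support, by
    \<open>sqrt_abs_add_ge\<close> with the worst coordinate size e.\<close>
  define k where "k = lam / (2 * (1 + \<theta>)\<^sup>2 * d)"
  have k: "k \<le> \<sigma>" using \<theta>\<sigma> d0 \<theta> by (simp add: k_def field_simps)
  define r where "r = A *v xs - y"
  obtain L where L: "0 < L" "\<And>w. norm (transpose A *v (A *v w)) \<le> L * norm w"
  proof -
    have "bounded_linear (\<lambda>w. transpose A *v (A *v w))"
      using bounded_linear_compose[OF matrix_vector_mul_bounded_linear matrix_vector_mul_bounded_linear] .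
    from bounded_linear.pos_bounded[OF this] obtain L
      where "0 < L" "\<And>w. norm (transpose A *v (A *v w)) \<le> norm w * L" by blast
    with that show ?thesis by (simp add: mult.commute)
  qed
  \<comment> \<open>Bounds the coefficient vector \<open>w\<close> of q for every p of norm at most
    e, so \<beta> can be fixed before the perturbation is known.\<close>
  define C where "C = 2 * (L * e + norm (transpose A *v r))"
  have C: "0 < C" unfolding C_def using L e by (intro mult_pos_pos add_pos_nonneg) auto
  \<comment> \<open>The first bound meets the hypothesis of \<open>sqrt_abs_add_ge\<close> on the
    support; the second yields C sqrt |h_i| <= lam off it.\<close>
  define \<beta> where "\<beta> = min (1 - \<theta>\<^sup>2) ((lam / C)\<^sup>2 / e)"
  have \<theta>2: "0 < \<theta>\<^sup>2" "\<theta>\<^sup>2 < 1" using \<theta> by (auto simp: power_less_one_iff)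
  have \<beta>: "0 < \<beta>" "\<beta> < 1"
    using \<theta>2 C lam e by (auto simp: \<beta>_def intro: min.strict_coboundedI1)
  have "T A y lam xs \<le> T A y lam z" if z: "norm (z - xs) < \<beta> * e" for z
  proof -
    define h where "h = z - xs"
    define p :: "real^'N" where "p = (\<chi> i. if i \<in> ?I then h $ i else 0)"
    define q :: "real^'N" where "q = (\<chi> i. if i \<in> ?I then 0 else h $ i)"
    define w where "w = 2 *\<^sub>R (transpose A *v (A *v p + r))"
    have zh: "z = xs + h" by (simp add: h_def)
    have hpq: "h = p + q" by (simp add: p_def q_def vec_eq_iff)
    have hi: "\<bar>h $ i\<bar> < \<beta> * e" for i
      using z component_le_norm_cart[of h i] by (simp add: h_def)
    have "norm p \<le> norm h" by (rule norm_le_componentwise_cart) (simp add: p_def)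
    moreover have "\<beta> * e \<le> 1 * e" using \<beta> e by (intro mult_right_mono) auto
    ultimately have np: "norm p \<le> e" using z by (simp add: h_def)
    have wC: "norm w \<le> C"
    proof -
      have "norm (transpose A *v (A *v p + r)) \<le> norm (transpose A *v (A *v p)) + norm (transpose A *v r)"
        by (simp add: matrix_vector_right_distrib norm_triangle_ineq)
      also have "norm (transpose A *v (A *v p)) \<le> L * norm p" by (rule L)
      also have "L * norm p \<le> L * e" using np L by simp
      finally show ?thesis by (simp add: w_def C_def)
    qed
    have adj: "(A *v a) \<bullet> b = a \<bullet> (transpose A *v b)" for a b
      by (metis dot_lmul_matrix inner_commute transpose_matrix_vector)
    have "(norm (A *v z - y))\<^sup>2 = (norm (r + A *v p + A *v q))\<^sup>2"
      by (simp add: zh hpq r_def matrix_vector_right_distrib algebra_simps)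
    also have "\<dots> = (norm r)\<^sup>2 + (norm (A *v p))\<^sup>2 + (norm (A *v q))\<^sup>2
        + 2 * ((A *v p) \<bullet> r) + 2 * ((A *v q) \<bullet> (A *v p + r))"
      by (simp add: power2_norm_eq_inner inner_add_left inner_add_right inner_commute)
    also have "2 * ((A *v q) \<bullet> (A *v p + r)) = q \<bullet> w" by (simp add: adj w_def)
    also have "(A *v p) \<bullet> r = p \<bullet> (transpose A *v r)" by (rule adj)
    finally have "(norm (A *v z - y))\<^sup>2 = (norm r)\<^sup>2 + (norm (A *v p))\<^sup>2 + (norm (A *v q))\<^sup>2
        + 2 * (p \<bullet> (transpose A *v r)) + q \<bullet> w" .
    moreover have "\<sigma> * (norm p)\<^sup>2 \<le> (norm (A *v p))\<^sup>2"
      unfolding \<sigma>_def by (rule sigma_min_gram_le_quadratic_form[OF supp_ne]) (simp add: p_def)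
    moreover have "0 \<le> (norm (A *v q))\<^sup>2" by simp
    ultimately have quad: "(norm (A *v z - y))\<^sup>2 \<ge> (norm r)\<^sup>2 + \<sigma> * (norm p)\<^sup>2
        + 2 * (p \<bullet> (transpose A *v r)) + q \<bullet> w"
      by linarith
    \<comment> \<open>After summation the terms \<open>k * (p $ i)\<^sup>2\<close> are paid for by
      \<sigma> |p|^2, since k <= \<sigma>.\<close>
    have coord: "lam * sqrt \<bar>xs $ i\<bar>
        \<le> lam * sqrt \<bar>z $ i\<bar> + 2 * (p $ i * (transpose A *v r) $ i) + q $ i * w $ i + k * (p $ i)\<^sup>2"
      for i
    proof (cases "i \<in> ?I")
      case True
      define a where "a = xs $ i"
      define b where "b = sqrt \<bar>a\<bar>"
      have a: "a \<noteq> 0" using True by (simp add: a_def supp_def)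
      then have b0: "0 < b" by (simp add: b_def)
      have ea: "e \<le> \<bar>a\<bar>" using ebd[OF True] by (simp add: a_def)
      have pi: "p $ i = h $ i" "q $ i = 0" using True by (simp_all add: p_def q_def)
      have "\<bar>h $ i\<bar> \<le> \<beta> * e" using hi[of i] by simp
      also have "\<dots> \<le> (1 - \<theta>\<^sup>2) * \<bar>a\<bar>" using ea e \<theta>2 by (intro mult_mono) (auto simp: \<beta>_def)
      finally have "sqrt \<bar>z $ i\<bar> \<ge> b + sgn a / (2 * b) * h $ i - (h $ i)\<^sup>2 / (2 * (1 + \<theta>)\<^sup>2 * b ^ 3)"
        using sqrt_abs_add_ge[OF a, of \<theta> "h $ i"] \<theta> by (simp add: zh a_def b_def)
      moreover have "(h $ i)\<^sup>2 / (2 * (1 + \<theta>)\<^sup>2 * b ^ 3) \<le> (h $ i)\<^sup>2 / (2 * (1 + \<theta>)\<^sup>2 * d)"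
      proof -
        have "d \<le> b ^ 3" unfolding d_def b_def using ea e by (intro power_mono) auto
        then show ?thesis using d0 b0 \<theta> by (intro divide_left_mono mult_left_mono mult_pos_pos) auto
      qed
      ultimately have "b + sgn a / (2 * b) * h $ i - (h $ i)\<^sup>2 / (2 * (1 + \<theta>)\<^sup>2 * d) \<le> sqrt \<bar>z $ i\<bar>"
        by linarith
      then have "lam * (b + sgn a / (2 * b) * h $ i - (h $ i)\<^sup>2 / (2 * (1 + \<theta>)\<^sup>2 * d)) \<le> lam * sqrt \<bar>z $ i\<bar>"
        using lam by simp
      \<comment> \<open>Stationarity cancels the linear term of the residual against that of the
        square root, leaving only the second-order loss.\<close>
      moreover have "2 * (h $ i * (transpose A *v r) $ i) = - (lam * (sgn a / (2 * b) * h $ i))"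
        using stat[OF True] by (simp add: r_def a_def b_def)
      moreover have "lam * ((h $ i)\<^sup>2 / (2 * (1 + \<theta>)\<^sup>2 * d)) = k * (h $ i)\<^sup>2"
        by (simp add: k_def)
      ultimately show ?thesis unfolding pi a_def[symmetric] b_def[symmetric]
        by (simp add: ring_distribs)
    next
      case False
      then have xs0: "xs $ i = 0" and pi: "p $ i = 0" "q $ i = h $ i"
        by (simp_all add: p_def q_def supp_def)
      define s where "s = sqrt \<bar>h $ i\<bar>"
      have s: "0 \<le> s" "\<bar>h $ i\<bar> = s * s" by (simp_all add: s_def)
      have "\<beta> * e \<le> (lam / C)\<^sup>2 / e * e" unfolding \<beta>_def using e by (intro mult_right_mono) auto
      then have "\<bar>h $ i\<bar> \<le> (lam / C)\<^sup>2" using hi[of i] e by simp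
      then have "s \<le> lam / C" unfolding s_def using lam C by (intro real_le_lsqrt) auto
      then have "C * s \<le> lam" using C by (simp add: field_simps)
      \<comment> \<open>The linear term is of order s^2, the penalty of order s; since C s <= lam,
        the penalty wins.\<close>
      have "\<bar>h $ i * w $ i\<bar> \<le> s * s * C"
        unfolding abs_mult s(2) using component_le_norm_cart[of w i] wC
        by (intro mult_left_mono) (auto simp: s)
      also have "\<dots> \<le> lam * s" using mult_right_mono[OF \<open>C * s \<le> lam\<close> s(1)] by (simp add: mult_ac)
      finally show ?thesis unfolding pi xs0 zh by (simp add: xs0 s_def abs_le_iff)
    qed
    have "lam * (\<Sum>i\<in>UNIV. sqrt \<bar>xs $ i\<bar>) = (\<Sum>i\<in>UNIV. lam * sqrt \<bar>xs $ i\<bar>)"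
      by (rule sum_distrib_left)
    also have "\<dots> \<le> (\<Sum>i\<in>UNIV. lam * sqrt \<bar>z $ i\<bar> + 2 * (p $ i * (transpose A *v r) $ i)
        + q $ i * w $ i + k * (p $ i)\<^sup>2)"
      by (intro sum_mono coord)
    also have "\<dots> = lam * (\<Sum>i\<in>UNIV. sqrt \<bar>z $ i\<bar>) + 2 * (p \<bullet> (transpose A *v r)) + q \<bullet> w
        + k * (norm p)\<^sup>2"
      unfolding power2_norm_eq_inner
      by (simp add: sum.distrib sum_distrib_left inner_vec_def power2_eq_square)
    also have "k * (norm p)\<^sup>2 \<le> \<sigma> * (norm p)\<^sup>2" using k by (intro mult_right_mono) auto
    finally show ?thesis using quad by (simp add: T_alt r_def)
  qed
  with \<beta> show ?thesis by blast
qed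

theorem theorem1:
  fixes A :: "real^'N^'m" and y :: "real^'m" and lam mu :: real
    and x :: "nat \<Rightarrow> real^'N" and xstar :: "real^'N"
    and I :: "'N set" and e :: real
  assumes "lam > 0"
    and "0 < mu" and "mu < 1 / (spectral_norm A)\<^sup>2"
    and "\<And>n. x (Suc n) = half_H (lam * mu) (x n - mu *\<^sub>R (transpose A *v (A *v x n - y)))"
    and "x \<longlonglongrightarrow> xstar"
    and "I = supp xstar" and "I \<noteq> {}"
    and "e = Min ((\<lambda>i. \<bar>xstar $ i\<bar>) ` I)"
    and "sigma_min_gram A I > 0"
    and "lam < 8 * e powr (3/2) * sigma_min_gram A I"
  shows "(\<exists>\<beta>\<^sub>0. 0 < \<beta>\<^sub>0 \<and> \<beta>\<^sub>0 < 1 \<and>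
            (\<forall>z. norm (z - xstar) < \<beta>\<^sub>0 * e \<longrightarrow> T A y lam z - T A y lam xstar \<ge> 0))
         \<and> (\<forall>\<^sub>F z in nhds xstar. T A y lam xstar \<le> T A y lam z)"
proof -
  have ebd: "e \<le> \<bar>xstar $ i\<bar>" if "i \<in> supp xstar" for i
    using that assms(6,8) by simp
  have "e \<in> (\<lambda>i. \<bar>xstar $ i\<bar>) ` I" using assms(7,8) by simp
  then have e: "0 < e" using assms(6) by (auto simp: supp_def)
  have stat: "(transpose A *v (A *v xstar - y)) $ i
      = - (lam / 4 * (sgn (xstar $ i) / sqrt \<bar>xstar $ i\<bar>))" if "i \<in> supp xstar" for i
    using half_iteration_limit_stationary[OF assms(1,2,4,5)] that by (simp add: supp_def)
  obtain \<beta> where \<beta>: "0 < \<beta>" "\<beta> < 1"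
    and min: "\<And>z. norm (z - xstar) < \<beta> * e \<Longrightarrow> T A y lam xstar \<le> T A y lam z"
    using T_ge_near_stationary_point[OF assms(1) e _ ebd stat] assms(6,7,10) by metis
  \<comment> \<open>The ball of radius \<beta> e is a neighbourhood because e, attained at a support
    coordinate, is positive.\<close>
  have "\<forall>\<^sub>F z in nhds xstar. T A y lam xstar \<le> T A y lam z"
    unfolding eventually_nhds_metric using \<beta> e min
    by (intro exI[of _ "\<beta> * e"]) (simp add: dist_norm)
  then show ?thesis using \<beta> min by (intro conjI exI[of _ \<beta>]) auto
qed

end
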